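(* Let $(X,\mathcal B)$ be a standard Borel space, $(T_n)_{n\in\mathbb N}$ a sequence in $Aut(X,\mathcal B)$ and $S\in Aut(X,\mathcal B)$. Then $T_n\to S$ in the topology $\overline p$ if and only if for every $F\in\mathcal B$ $$SF=\bigcup_{m}\bigcap_{n>m}T_nF\quad\text{and}\quad S^{-1}F=\bigcup_m\bigcap_{n>m}T_n^{-1}F .$$
   Context: $Aut(X,\mathcal B)$ is the group of all one-to-one Borel automorphisms of $X$, and $\mathcal M_1(X)$ is the set of Borel probability measures on $X$. The topology $\overline p$ on $Aut(X,\mathcal B)$ has as a base of neighborhoods the sets $$\overline W(T;F_1,\dots,F_k;\mu_1,\dots,\mu_n;\varepsilon)=\{S:\mu_j(SF_i\,\Delta\, TF_i)+\mu_j(S^{-1}F_i\,\Delta\, T^{-1}F_i)<\varepsilon,\ i=1,\dots,k,\ j=1,\dots,n\},$$ where $T\in Aut(X,\mathcal B)$, $F_i\in\mathcal B$, $\mu_j\in\mathcal M_1(X)$, $\varepsilon>0$. *)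

theory Defs
  imports "HOL-Probability.Probability"
begin

text \<open>
  As usual in the library, a measurable space \<open>(X, \<B>)\<close> is given by a value \<open>M\<close> of type
  \<^typ>\<open>'a measure\<close>, of which only \<open>space M\<close> and \<open>sets M\<close> are used.
\<close>

definition standard_borel :: "'a measure \<Rightarrow> bool" where
  "standard_borel M \<longleftrightarrow>
     (\<exists>\<O> :: 'a topology. completely_metrizable_space \<O> \<and> separable_space \<O> \<and>
        topspace \<O> = space M \<and> sets M = sigma_sets (space M) {U. openin \<O> U})"

text \<open>
  Automorphisms are required to be \<^const>\<open>extensional\<close>, so that they are determined by their
  values on the space and distinct elements of the set below are distinct maps of \<open>X\<close>.
\<close>

definition borel_aut :: "'a measure \<Rightarrow> ('a \<Rightarrow> 'a) set" where
  "borel_aut M =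
     {T \<in> extensional (space M). bij_betw T (space M) (space M) \<and>
        T \<in> measurable M M \<and> inv_into (space M) T \<in> measurable M M}"

definition borel_probs :: "'a measure \<Rightarrow> 'a measure set" where
  "borel_probs M = {\<mu>. prob_space \<mu> \<and> sets \<mu> = sets M}"

text \<open>
  The finite lists \<open>F\<^sub>1, \<dots>, F\<^sub>k\<close> and \<open>\<mu>\<^sub>1, \<dots>, \<mu>\<^sub>n\<close> appear as the finite sets \<open>\<F>\<close> and \<open>\<N>\<close>.
  For \<open>F \<subseteq> X\<close>, the set \<open>T\<^sup>-\<^sup>1F\<close> is the preimage \<open>T -` F \<inter> space M\<close>.
\<close>

definition W_bar :: "'a measure \<Rightarrow> ('a \<Rightarrow> 'a) \<Rightarrow> 'a set set \<Rightarrow> 'a measure set \<Rightarrow> real \<Rightarrow> ('a \<Rightarrow> 'a) set" where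
  "W_bar M T \<F> \<N> \<epsilon> =
     {S \<in> borel_aut M. \<forall>F\<in>\<F>. \<forall>\<mu>\<in>\<N>.
        measure \<mu> (sym_diff (S ` F) (T ` F)) +
        measure \<mu> (sym_diff (S -` F \<inter> space M) (T -` F \<inter> space M)) < \<epsilon>}"

text \<open>
  Empty \<open>\<F>\<close> and \<open>\<N>\<close> are allowed.  This only matters when \<open>X\<close> is empty: then there are no
  probability measures, and the topology still has to live on all of \<open>borel_aut M\<close>.
\<close>

definition p_bar_topology :: "'a measure \<Rightarrow> ('a \<Rightarrow> 'a) topology" where
  "p_bar_topology M =
     topology_generated_by
       {W_bar M T \<F> \<N> \<epsilon> | T \<F> \<N> \<epsilon>. T \<in> borel_aut M \<and> finite \<F> \<and> \<F> \<subseteq> sets M \<and>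
          finite \<N> \<and> \<N> \<subseteq> borel_probs M \<and> \<epsilon> > 0}"

lemma W_bar_self: "T \<in> borel_aut M \<Longrightarrow> 0 < \<epsilon> \<Longrightarrow> T \<in> W_bar M T \<F> \<N> \<epsilon>"
  by (simp add: W_bar_def)

lemma topspace_p_bar: "topspace (p_bar_topology M) = borel_aut M"
proof -
  let ?\<W> = "{W_bar M T \<F> \<N> \<epsilon> | T \<F> \<N> \<epsilon>. T \<in> borel_aut M \<and> finite \<F> \<and> \<F> \<subseteq> sets M \<and>
          finite \<N> \<and> \<N> \<subseteq> borel_probs M \<and> (\<epsilon>::real) > 0}"
  have "\<Union>?\<W> \<subseteq> borel_aut M"
    by (auto simp: W_bar_def)
  moreover have "T \<in> \<Union>?\<W>" if T: "T \<in> borel_aut M" for T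
  proof (rule UnionI)
    show "T \<in> W_bar M T {} {} 1" using T by (rule W_bar_self) simp
    show "W_bar M T {} {} 1 \<in> ?\<W>"
      using T by (intro CollectI exI[of _ T] exI[of _ "{}"] exI[of _ "1::real"] conjI) simp_all
  qed
  ultimately show ?thesis
    unfolding p_bar_topology_def topology_generated_by_topspace
    by (intro subset_antisym subsetI[of "borel_aut M"])
qed

lemma image_borel_aut_sets:
  assumes "T \<in> borel_aut M" "F \<in> sets M"
  shows "T ` F \<in> sets M"
proof -
  have b: "bij_betw T (space M) (space M)" and m: "inv_into (space M) T \<in> measurable M M"
    using assms(1) by (auto simp: borel_aut_def)
  have "F \<subseteq> space M" using assms(2) by (rule sets.sets_into_space)
  then have "T ` F = inv_into (space M) T -` F \<inter> space M"
  proof (intro set_eqI iffI)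
    fix y assume "y \<in> T ` F"
    then show "y \<in> inv_into (space M) T -` F \<inter> space M"
      using \<open>F \<subseteq> space M\<close> bij_betw_imp_surj_on[OF b] inv_into_f_f[OF bij_betw_imp_inj_on[OF b]]
      by auto
  next
    fix y assume y: "y \<in> inv_into (space M) T -` F \<inter> space M"
    then have "T (inv_into (space M) T y) = y"
      using bij_betw_inv_into_right[OF b] by simp
    then show "y \<in> T ` F" using y by (metis IntD1 image_eqI vimageD)
  qed
  then show ?thesis using measurable_sets[OF m assms(2)] by simp
qed

lemma vimage_borel_aut_sets:
  assumes "T \<in> borel_aut M" "F \<in> sets M"
  shows "T -` F \<inter> space M \<in> sets M"
  using assms by (auto simp: borel_aut_def intro: measurable_sets)

lemma measure_sym_diff_triangle:
  assumes "\<mu> \<in> borel_probs M" "A \<in> sets M" "B \<in> sets M" "C \<in> sets M"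
  shows "measure \<mu> (sym_diff A C) \<le> measure \<mu> (sym_diff A B) + measure \<mu> (sym_diff B C)"
proof -
  interpret prob_space \<mu> using assms(1) by (simp add: borel_probs_def)
  have s: "A \<in> sets \<mu>" "B \<in> sets \<mu>" "C \<in> sets \<mu>" using assms by (auto simp: borel_probs_def)
  have "measure \<mu> (sym_diff A C) \<le> measure \<mu> (sym_diff A B \<union> sym_diff B C)"
    using s by (intro finite_measure_mono) auto
  also have "\<dots> \<le> measure \<mu> (sym_diff A B) + measure \<mu> (sym_diff B C)"
    using s by (intro measure_Un_le) auto
  finally show ?thesis .
qed

lemma W_bar_contains_ball:
  assumes T: "T \<in> borel_aut M" and F: "finite \<F>" "\<F> \<subseteq> sets M"
    and N: "finite \<N>" "\<N> \<subseteq> borel_probs M" and R: "R \<in> W_bar M T \<F> \<N> \<epsilon>"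
  shows "\<exists>\<delta>>0. W_bar M R \<F> \<N> \<delta> \<subseteq> W_bar M T \<F> \<N> \<epsilon>"
proof -
  define d where "d = (\<lambda>S S' F \<mu>. measure \<mu> (sym_diff (S ` F) (S' ` F)) +
        measure \<mu> (sym_diff (S -` F \<inter> space M) (S' -` F \<inter> space M)))"
  have W: "W_bar M S \<F> \<N> e = {S' \<in> borel_aut M. \<forall>F\<in>\<F>. \<forall>\<mu>\<in>\<N>. d S' S F \<mu> < e}" for S e
    by (simp add: W_bar_def d_def)
  have RA: "R \<in> borel_aut M" using R by (simp add: W)
  define E where "E = insert 1 ((\<lambda>(F, \<mu>). \<epsilon> - d R T F \<mu>) ` (\<F> \<times> \<N>))"
  have fE: "finite E" "E \<noteq> {}" using F N by (auto simp: E_def)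
  have pos: "Min E > 0" using fE R by (auto simp: E_def W)
  have "W_bar M R \<F> \<N> (Min E) \<subseteq> W_bar M T \<F> \<N> \<epsilon>"
  proof
    fix S assume S: "S \<in> W_bar M R \<F> \<N> (Min E)"
    then have SA: "S \<in> borel_aut M" by (simp add: W)
    have "d S T G \<mu> < \<epsilon>" if G: "G \<in> \<F>" "\<mu> \<in> \<N>" for G \<mu>
    proof -
      have Gs: "G \<in> sets M" and mu: "\<mu> \<in> borel_probs M" using G F N by auto
      have "d S R G \<mu> < Min E" using S G by (simp add: W)
      moreover have "Min E \<le> \<epsilon> - d R T G \<mu>" using fE(1) G by (intro Min_le) (auto simp: E_def)
      moreover have "d S T G \<mu> \<le> d S R G \<mu> + d R T G \<mu>"
        using measure_sym_diff_triangle[OF mu image_borel_aut_sets[OF SA Gs]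
            image_borel_aut_sets[OF RA Gs] image_borel_aut_sets[OF T Gs]]
          measure_sym_diff_triangle[OF mu vimage_borel_aut_sets[OF SA Gs]
            vimage_borel_aut_sets[OF RA Gs] vimage_borel_aut_sets[OF T Gs]]
        unfolding d_def by linarith
      ultimately show ?thesis by linarith
    qed
    then show "S \<in> W_bar M T \<F> \<N> \<epsilon>" using SA by (simp add: W)
  qed
  then show ?thesis using pos by blast
qed

text \<open>
  The sets \<open>W_bar M T \<F> \<N> \<epsilon>\<close> are not just a subbase but form a neighbourhood base at \<open>T\<close>.
\<close>

lemma openin_p_bar_iff:
  "openin (p_bar_topology M) U \<longleftrightarrow>
     U \<subseteq> borel_aut M \<and>
     (\<forall>T\<in>U. \<exists>\<F> \<N> \<epsilon>. finite \<F> \<and> \<F> \<subseteq> sets M \<and> finite \<N> \<and> \<N> \<subseteq> borel_probs M \<and> \<epsilon> > 0 \<and>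
        W_bar M T \<F> \<N> \<epsilon> \<subseteq> U)"
    (is "_ \<longleftrightarrow> _ \<and> (\<forall>T\<in>U. ?nb T U)")
proof
  assume o: "openin (p_bar_topology M) U"
  then have "U \<subseteq> borel_aut M" using openin_subset topspace_p_bar by blast
  moreover have "\<forall>T\<in>U. ?nb T U"
    using o[unfolded p_bar_topology_def openin_topology_generated_by_iff]
  proof induction
    case Empty
    then show ?case by simp
  next
    case (Int a b)
    show ?case
    proof
      fix T assume T: "T \<in> a \<inter> b"
      obtain \<F> \<N> \<epsilon> where 1: "finite \<F>" "\<F> \<subseteq> sets M" "finite \<N>" "\<N> \<subseteq> borel_probs M" "\<epsilon> > 0"
        "W_bar M T \<F> \<N> \<epsilon> \<subseteq> a" using bspec[OF Int.IH(1) IntD1[OF T]] by (elim exE conjE)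
      obtain \<F>' \<N>' \<epsilon>' where 2: "finite \<F>'" "\<F>' \<subseteq> sets M" "finite \<N>'" "\<N>' \<subseteq> borel_probs M" "\<epsilon>' > 0"
        "W_bar M T \<F>' \<N>' \<epsilon>' \<subseteq> b" using bspec[OF Int.IH(2) IntD2[OF T]] by (elim exE conjE)
      have "W_bar M T (\<F> \<union> \<F>') (\<N> \<union> \<N>') (min \<epsilon> \<epsilon>') \<subseteq> W_bar M T \<F> \<N> \<epsilon> \<inter> W_bar M T \<F>' \<N>' \<epsilon>'"
        by (auto simp: W_bar_def)
      also have "\<dots> \<subseteq> a \<inter> b" using 1(6) 2(6) by (rule Int_mono)
      finally show "?nb T (a \<inter> b)"
        using 1 2
        by (intro exI[of _ "\<F> \<union> \<F>'"] exI[of _ "\<N> \<union> \<N>'"] exI[of _ "min \<epsilon> \<epsilon>'"] conjI) simp_all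
    qed
  next
    case (UN K)
    show ?case
    proof
      fix T assume "T \<in> \<Union>K"
      then obtain k where k: "k \<in> K" "T \<in> k" by blast
      obtain \<F> \<N> \<epsilon> where 1: "finite \<F>" "\<F> \<subseteq> sets M" "finite \<N>" "\<N> \<subseteq> borel_probs M" "\<epsilon> > 0"
        "W_bar M T \<F> \<N> \<epsilon> \<subseteq> k" using bspec[OF UN.IH[OF k(1)] k(2)] by (elim exE conjE)
      have "W_bar M T \<F> \<N> \<epsilon> \<subseteq> \<Union>K" using 1(6) Union_upper[OF k(1)] by (rule subset_trans)
      then show "?nb T (\<Union>K)"
        using 1 by (intro exI[of _ \<F>] exI[of _ \<N>] exI[of _ \<epsilon>] conjI)
    qed
  next
    case (Basis s)
    then obtain T \<F> \<N> \<epsilon> where s: "s = W_bar M T \<F> \<N> \<epsilon>" "T \<in> borel_aut M" "finite \<F>"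
      "\<F> \<subseteq> sets M" "finite \<N>" "\<N> \<subseteq> borel_probs M"
      unfolding mem_Collect_eq by (elim exE conjE)
    show ?case
    proof
      fix R assume "R \<in> s"
      then have "\<exists>\<delta>>0. W_bar M R \<F> \<N> \<delta> \<subseteq> s"
        unfolding s(1) by (rule W_bar_contains_ball[OF s(2-6)])
      then obtain \<delta> where "\<delta> > 0" "W_bar M R \<F> \<N> \<delta> \<subseteq> s" by (elim exE conjE)
      then show "?nb R s"
        using s(3-6) by (intro exI[of _ \<F>] exI[of _ \<N>] exI[of _ \<delta>] conjI)
    qed
  qed
  ultimately show "U \<subseteq> borel_aut M \<and> (\<forall>T\<in>U. ?nb T U)" by (rule conjI)
next
  assume a: "U \<subseteq> borel_aut M \<and> (\<forall>T\<in>U. ?nb T U)"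
  show "openin (p_bar_topology M) U"
  proof (subst openin_subopen, intro ballI)
    fix T assume T: "T \<in> U"
    obtain \<F> \<N> \<epsilon> where 1: "finite \<F>" "\<F> \<subseteq> sets M" "finite \<N>" "\<N> \<subseteq> borel_probs M"
      "\<epsilon> > 0" "W_bar M T \<F> \<N> \<epsilon> \<subseteq> U" using bspec[OF conjunct2[OF a] T] by (elim exE conjE)
    have TA: "T \<in> borel_aut M" using conjunct1[OF a] T by (rule subsetD)
    have "openin (p_bar_topology M) (W_bar M T \<F> \<N> \<epsilon>)"
      unfolding p_bar_topology_def using 1 TA by (intro topology_generated_by_Basis) blast
    then show "\<exists>V. openin (p_bar_topology M) V \<and> T \<in> V \<and> V \<subseteq> U"
      using W_bar_self[OF TA 1(5)] 1(6) by (intro exI[of _ "W_bar M T \<F> \<N> \<epsilon>"] conjI)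
  qed
qed

end

theory Submission
  imports Defs
begin

text \<open>
  Testing against point masses, a sequence of measurable sets converges to \<open>B\<close> in every
  \<open>\<mu>\<close>-pseudometric only if its indicators converge pointwise; the converse is dominated
  convergence. Pointwise convergence in turn means that both the sets and their complements have
  the expected lower limits, and a bijection commutes with complements, so the condition on lower
  limits for \<open>F\<close> and \<open>X - F\<close> together gives pointwise convergence for \<open>F\<close>.
\<close>

text \<open>The sets need not decrease, so continuity from above does not apply directly. Instead
  the indicators tend to 0 pointwise and are dominated by the constant 1, which is integrable for a
  finite measure.\<close>

lemma tendsto_measure_pointwise_vanishing:
  assumes "finite_measure \<mu>" and A: "\<And>n. A n \<in> sets \<mu>"
    and ev: "\<And>x. x \<in> space \<mu> \<Longrightarrow> eventually (\<lambda>n. x \<notin> A n) sequentially"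
  shows "(\<lambda>n. measure \<mu> (A n)) \<longlonglongrightarrow> 0"
proof -
  interpret finite_measure \<mu> by fact
  have "(\<lambda>n. \<integral>x. indicat_real (A n) x \<partial>\<mu>) \<longlonglongrightarrow> (\<integral>x. 0 \<partial>\<mu>)"
  proof (rule integral_dominated_convergence[where w = "\<lambda>_. 1"])
    show "AE x in \<mu>. (\<lambda>n. indicat_real (A n) x) \<longlonglongrightarrow> 0"
    proof (rule AE_I2)
      fix x assume "x \<in> space \<mu>"
      from ev[OF this] show "(\<lambda>n. indicat_real (A n) x) \<longlonglongrightarrow> 0"
        by (intro tendsto_eventually) (auto elim!: eventually_mono)
    qed
  qed (use A in \<open>auto simp: indicator_def\<close>)
  then show ?thesis
    using A by (simp add: sets.Int_space_eq2)
qed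

lemma all_borel_probs_tendsto_iff:
  assumes A: "\<And>n. A n \<in> sets M" and B: "B \<in> sets M"
  shows "(\<forall>\<mu>\<in>borel_probs M. (\<lambda>n. measure \<mu> (sym_diff (A n) B)) \<longlonglongrightarrow> 0) \<longleftrightarrow>
    (\<forall>x\<in>space M. eventually (\<lambda>n. x \<in> A n \<longleftrightarrow> x \<in> B) sequentially)"
proof (intro iffI ballI)
  fix x assume lim: "\<forall>\<mu>\<in>borel_probs M. (\<lambda>n. measure \<mu> (sym_diff (A n) B)) \<longlonglongrightarrow> 0"
    and x: "x \<in> space M"
  have "return M x \<in> borel_probs M"
    using x by (simp add: borel_probs_def prob_space_return)
  \<comment> \<open>A point mass takes only the values 0 and 1, so a value below 1 says that
    \<open>x\<close> lies outside the symmetric difference.\<close>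
  with lim have "eventually (\<lambda>n. measure (return M x) (sym_diff (A n) B) < 1) sequentially"
    by (intro order_tendstoD(2)[of _ 0]) auto
  then show "eventually (\<lambda>n. x \<in> A n \<longleftrightarrow> x \<in> B) sequentially"
    by (rule eventually_mono) (use A B in \<open>auto simp: measure_return indicator_def split: if_splits\<close>)
next
  fix \<mu> assume ev: "\<forall>x\<in>space M. eventually (\<lambda>n. x \<in> A n \<longleftrightarrow> x \<in> B) sequentially"
    and mu: "\<mu> \<in> borel_probs M"
  interpret prob_space \<mu> using mu by (simp add: borel_probs_def)
  have sets: "sets \<mu> = sets M" using mu by (simp add: borel_probs_def)
  then have "space \<mu> = space M" by (rule sets_eq_imp_space_eq)
  then show "(\<lambda>n. measure \<mu> (sym_diff (A n) B)) \<longlonglongrightarrow> 0"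
    using A B ev sets finite_measure_axioms
    by (intro tendsto_measure_pointwise_vanishing) (auto elim!: eventually_mono)
qed

text \<open>Basic neighbourhoods test only finitely many pairs of a set and a measure, so finitely
  many eventual conditions can be combined; conversely each single pair already gives a
  neighbourhood of \<open>S\<close>.\<close>

lemma limitin_p_bar_iff:
  assumes T: "\<And>n. T n \<in> borel_aut M" and S: "S \<in> borel_aut M"
  shows "limitin (p_bar_topology M) T S sequentially \<longleftrightarrow>
    (\<forall>F\<in>sets M. \<forall>\<mu>\<in>borel_probs M.
       (\<lambda>n. measure \<mu> (sym_diff (T n ` F) (S ` F))) \<longlonglongrightarrow> 0 \<and>
       (\<lambda>n. measure \<mu> (sym_diff (T n -` F \<inter> space M) (S -` F \<inter> space M))) \<longlonglongrightarrow> 0)"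
    (is "_ \<longleftrightarrow> (\<forall>F\<in>sets M. \<forall>\<mu>\<in>borel_probs M. ?a F \<mu> \<longlonglongrightarrow> 0 \<and> ?b F \<mu> \<longlonglongrightarrow> 0)")
proof (intro iffI ballI)
  fix F \<mu> assume lim: "limitin (p_bar_topology M) T S sequentially"
    and F: "F \<in> sets M" and mu: "\<mu> \<in> borel_probs M"
  have ev: "eventually (\<lambda>n. ?a F \<mu> n + ?b F \<mu> n < e) sequentially" if e: "0 < e" for e :: real
  proof -
    have "openin (p_bar_topology M) (W_bar M S {F} {\<mu>} e)"
      unfolding p_bar_topology_def
      using S F mu e by (intro topology_generated_by_Basis) blast
    with lim have "eventually (\<lambda>n. T n \<in> W_bar M S {F} {\<mu>} e) sequentially"
      using W_bar_self[OF S e] by (simp add: limitin_def)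
    then show ?thesis by (rule eventually_mono) (simp add: W_bar_def)
  qed
  show "?a F \<mu> \<longlonglongrightarrow> 0 \<and> ?b F \<mu> \<longlonglongrightarrow> 0"
  proof (intro conjI order_tendstoI)
    fix e :: real assume "0 < e"
    note ev = ev[OF this]
    show "eventually (\<lambda>n. ?a F \<mu> n < e) sequentially"
      using ev by (rule eventually_mono) (erule le_less_trans[rotated], simp)
    show "eventually (\<lambda>n. ?b F \<mu> n < e) sequentially"
      using ev by (rule eventually_mono) (erule le_less_trans[rotated], simp)
  \<comment> \<open>The lower bounds: every negative number lies below both measures.\<close>
  qed (rule always_eventually, rule allI, erule less_le_trans, rule measure_nonneg)+
next
  assume lim: "\<forall>F\<in>sets M. \<forall>\<mu>\<in>borel_probs M. ?a F \<mu> \<longlonglongrightarrow> 0 \<and> ?b F \<mu> \<longlonglongrightarrow> 0"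
  show "limitin (p_bar_topology M) T S sequentially"
    unfolding limitin_def
  proof (intro conjI allI impI)
    \<comment> \<open>The neighbourhood base provides a set centred at \<open>S\<close> itself; a
      generator containing \<open>S\<close> may be centred elsewhere.\<close>
    fix U assume "openin (p_bar_topology M) U \<and> S \<in> U"
    then obtain \<F> \<N> e where fin: "finite \<F>" "finite \<N>" and sub: "\<F> \<subseteq> sets M" "\<N> \<subseteq> borel_probs M"
      and e: "e > 0" and W: "W_bar M S \<F> \<N> e \<subseteq> U"
      unfolding openin_p_bar_iff by meson
    have "eventually (\<lambda>n. \<forall>F\<in>\<F>. \<forall>\<mu>\<in>\<N>. ?a F \<mu> n + ?b F \<mu> n < e) sequentially"
    proof (intro eventually_ball_finite fin ballI)
      fix F \<mu> assume "F \<in> \<F>" "\<mu> \<in> \<N>"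
      with lim sub have "?a F \<mu> \<longlonglongrightarrow> 0" "?b F \<mu> \<longlonglongrightarrow> 0" by blast+
      from tendsto_add[OF this] e
      show "eventually (\<lambda>n. ?a F \<mu> n + ?b F \<mu> n < e) sequentially"
        by (intro order_tendstoD(2)) auto
    qed
    then show "eventually (\<lambda>n. T n \<in> U) sequentially"
      by (rule eventually_mono) (use W T in \<open>auto simp: W_bar_def\<close>)
  qed (use S in \<open>simp add: topspace_p_bar\<close>)
qed

text \<open>The strict bound \<open>m < n\<close> in the lower limit is the one in
  \<open>eventually_at_top_dense\<close>.\<close>

lemma mem_liminf_iff:
  "x \<in> (\<Union>m. \<Inter>n\<in>{m<..}. A n) \<longleftrightarrow> eventually (\<lambda>n. x \<in> A n) sequentially"
  unfolding eventually_at_top_dense by blast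

lemma liminf_eq_if_eventually_mem_iff:
  assumes sub: "\<And>n. A n \<subseteq> X" "B \<subseteq> X"
    and ev: "\<And>x. x \<in> X \<Longrightarrow> eventually (\<lambda>n. x \<in> A n \<longleftrightarrow> x \<in> B) sequentially"
  shows "B = (\<Union>m. \<Inter>n\<in>{m<..}. A n)"
proof (rule set_eqI, unfold mem_liminf_iff)
  fix x
  show "x \<in> B \<longleftrightarrow> eventually (\<lambda>n. x \<in> A n) sequentially"
  proof (cases "x \<in> X")
    case True
    have "eventually (\<lambda>n. x \<in> A n) sequentially \<longleftrightarrow> eventually (\<lambda>n::nat. x \<in> B) sequentially"
      by (rule eventually_cong[OF ev[OF True]])
    \<comment> \<open>On a nontrivial filter, a condition independent of \<open>n\<close> holds
      eventually iff it holds.\<close>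
    then show ?thesis by (simp add: eventually_const)
  next
    case False
    then have "x \<notin> B" "\<And>n. x \<notin> A n" using sub by blast+
    then show ?thesis by simp
  qed
qed

text \<open>The first equation leaves open that a point outside \<open>B\<close> lies in infinitely
  many \<open>A n\<close> while missing infinitely many; the equation for complements excludes
  this.\<close>

lemma eventually_mem_iff_if_liminf_eq:
  assumes "B = (\<Union>m. \<Inter>n\<in>{m<..}. A n)"
    and "X - B = (\<Union>m. \<Inter>n\<in>{m<..}. X - A n)" and "x \<in> X"
  shows "eventually (\<lambda>n. x \<in> A n \<longleftrightarrow> x \<in> B) sequentially"
proof (cases "x \<in> B")
  case True
  then have "eventually (\<lambda>n. x \<in> A n) sequentially"
    using mem_liminf_iff[of x A] assms(1) by simp
  then show ?thesis by (rule eventually_mono) (simp add: True)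
next
  case False
  then have "eventually (\<lambda>n. x \<in> X - A n) sequentially"
    using mem_liminf_iff[of x "\<lambda>n. X - A n"] assms(2,3) by blast
  then show ?thesis by (rule eventually_mono) (simp add: False)
qed

text \<open>Injectivity lets the image commute with the difference, and surjectivity maps the space
  onto itself.\<close>

lemma image_borel_aut_Compl:
  assumes "T \<in> borel_aut M" "F \<subseteq> space M"
  shows "T ` (space M - F) = space M - T ` F"
  using assms by (simp add: borel_aut_def bij_betw_def inj_on_image_set_diff[of T "space M"])

lemma vimage_borel_aut_Compl:
  assumes "T \<in> borel_aut M"
  shows "T -` (space M - F) \<inter> space M = space M - (T -` F \<inter> space M)"
  using assms by (auto simp: borel_aut_def dest: measurable_space)

theorem proposition1p13:
  fixes M :: "'a measure" and T :: "nat \<Rightarrow> 'a \<Rightarrow> 'a" and S :: "'a \<Rightarrow> 'a"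
  assumes "standard_borel M"
    and "\<And>n. T n \<in> borel_aut M"
    and "S \<in> borel_aut M"
  shows "limitin (p_bar_topology M) T S sequentially \<longleftrightarrow>
    (\<forall>F\<in>sets M.
       S ` F = (\<Union>m. \<Inter>n\<in>{m<..}. T n ` F) \<and>
       S -` F \<inter> space M = (\<Union>m. \<Inter>n\<in>{m<..}. T n -` F \<inter> space M))"
    (is "_ \<longleftrightarrow> (\<forall>F\<in>sets M. ?liminf F)")
proof -
  let ?pt = "\<lambda>F. (\<forall>x\<in>space M. eventually (\<lambda>n. x \<in> T n ` F \<longleftrightarrow> x \<in> S ` F) sequentially) \<and>
    (\<forall>x\<in>space M. eventually (\<lambda>n. x \<in> T n -` F \<inter> space M \<longleftrightarrow> x \<in> S -` F \<inter> space M) sequentially)"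
  note image_sets = image_borel_aut_sets[OF assms(2)] image_borel_aut_sets[OF assms(3)]
  note vimage_sets = vimage_borel_aut_sets[OF assms(2)] vimage_borel_aut_sets[OF assms(3)]
  have "limitin (p_bar_topology M) T S sequentially \<longleftrightarrow> (\<forall>F\<in>sets M. ?pt F)"
    \<comment> \<open>Images and preimages are separated so that the criterion for sequences of sets
      applies to each; \<open>ball_cong\<close> supplies \<open>F \<in> sets M\<close> for its
      measurability premises.\<close>
    unfolding limitin_p_bar_iff[OF assms(2,3)] ball_conj_distrib
    by (simp only: all_borel_probs_tendsto_iff image_sets vimage_sets cong: ball_cong)
  also have "\<dots> \<longleftrightarrow> (\<forall>F\<in>sets M. ?liminf F)"
  proof (intro iffI ballI)
    fix F assume pt: "\<forall>F\<in>sets M. ?pt F" and F: "F \<in> sets M"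
    have "T n ` F \<subseteq> space M" "S ` F \<subseteq> space M" for n
      using image_sets[OF F] by (auto dest: sets.sets_into_space)
    with pt F show "?liminf F"
      by (intro conjI liminf_eq_if_eventually_mem_iff[of _ "space M"]) blast+
  next
    fix F assume lim: "\<forall>F\<in>sets M. ?liminf F" and F: "F \<in> sets M"
    have sub: "F \<subseteq> space M" using F by (rule sets.sets_into_space)
    \<comment> \<open>The hypothesis is used at \<open>F\<close> and at its complement, whose images
      and preimages are the complements of those of \<open>F\<close>.\<close>
    from bspec[OF lim F] bspec[OF lim sets.compl_sets[OF F]] show "?pt F"
      unfolding image_borel_aut_Compl[OF assms(2) sub] image_borel_aut_Compl[OF assms(3) sub]
        vimage_borel_aut_Compl[OF assms(2)] vimage_borel_aut_Compl[OF assms(3)]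
      by (elim conjE) (intro conjI ballI eventually_mem_iff_if_liminf_eq)
  qed
  finally show ?thesis .
qed

end
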